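(* Let $D$ be a nonempty convex subset of a Hausdorff locally convex vector space, let $f\colon D\to\mathbb R$ be convex with finite curvature $C_f<+\infty$, and suppose $\mathrm{gap}(x;s)<+\infty$ for all $x,s\in D$. Let $(X^n)_{n\in\mathbb N}$ and $(S^n)_{n\ge1}$ be random sequences in $D$ generated by the Frank–Wolfe algorithm described in the context, and let $(\mathcal F^n)_{n\in\mathbb N}$ be the filtration they generate. Suppose that for all $\epsilon>0$ and all $n\in\mathbb N$ there is a deterministic $p_n(\epsilon)>0$ such that $$\mathbb P\big(\mathrm{gap}(X^n;S^{n+1})<\epsilon\,\big|\,\mathcal F^n\big)\ge p_n(\epsilon)\quad\text{almost surely},$$ and $\sum_{n=1}^\infty p_n(\epsilon)=+\infty$. Then, almost surely, $(X^n)_{n\in\mathbb N}$ is a minimising sequence, i.e. $\lim_{n\to\infty}f(X^n)=\inf_D f$.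
   Context: For $x\in D$ and $h\in D-x$, $f'(x;h)=\lim_{t\to0^+}\frac{f(x+th)-f(x)}{t}\in\mathbb R\cup\{-\infty\}$ is the directional derivative. The curvature is $$C_f=\sup_{x,\tilde x\in D,\ \lambda\in(0,1)}\frac{f(x+\lambda(\tilde x-x))-f(x)-\lambda f'(x;\tilde x-x)}{\lambda^2},$$ and its finiteness includes that all $f'(x;\tilde x-x)$ are finite. The gap is $\mathrm{gap}(x;s)=f'(x;s-x)-\inf_{\tilde s\in D}f'(x;\tilde s-x)\ge 0$. Algorithm: $X^0\in D$ is random. For each $n\ge0$, a random point $S^{n+1}\in D$ is picked (it may depend on $X^0,\dots,X^n,S^1,\dots,S^n$); then $\lambda_n\in\operatorname{argmin}_{\lambda\in[0,1]}f((1-\lambda)X^n+\lambda S^{n+1})$ (exact line search, assumed attained); then $X^{n+1}\in D$ is any (random) point with $f(X^{n+1})\le f((1-\lambda_n)X^n+\lambda_nS^{n+1})$. $\mathcal F^n$ is the $\sigma$-algebra generated by $X^0,\dots,X^n$ and $S^1,\dots,S^n$. It is understood that the relevant real-valued quantities are measurable, so that each $\mathrm{gap}(X^n;S^{n+1})$ is an $\mathcal F^{n+1}$-measurable random variable. *)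

theory Defs
  imports "HOL-Probability.Probability"
begin

text \<open>Hausdorff locally convex real vector spaces; no norm, metric or countability is assumed.
  Convexity of the neighbourhood \<open>V\<close> is spelled out because the constant \<open>convex\<close>, having sort
  \<open>real_vector\<close>, cannot occur in a class specification.\<close>

class locally_convex_t2_space = real_vector + topological_ab_group_add + t2_space +
  assumes tendsto_scaleR_Pair:
    "LIM z (nhds r \<times>\<^sub>F nhds a). fst z *\<^sub>R snd z :> nhds (r *\<^sub>R a)"
  assumes locally_convex_at_0:
    "open U \<Longrightarrow> 0 \<in> U \<Longrightarrow> \<exists>V. open V \<and> 0 \<in> V \<and> V \<subseteq> U \<and>
      (\<forall>x\<in>V. \<forall>y\<in>V. \<forall>u\<ge>0. \<forall>v\<ge>0. u + v = 1 \<longrightarrow> u *\<^sub>R x + v *\<^sub>R y \<in> V)"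

text \<open>
  A function on \<open>D\<close> is represented by a total function. For convex \<open>D\<close>, \<open>x \<in> D\<close>
  and \<open>h \<in> D - x\<close>, all points \<open>x + t h\<close> with \<open>0 < t < 1\<close> lie in \<open>D\<close>, so the one-sided limit
  below does not see the values outside \<open>D\<close>.
\<close>

definition dir_deriv :: "('a::real_vector \<Rightarrow> real) \<Rightarrow> 'a \<Rightarrow> 'a \<Rightarrow> ereal" where
  "dir_deriv f x h = Lim (at_right 0) (\<lambda>t. ereal ((f (x + t *\<^sub>R h) - f x) / t))"

text \<open>
  If some directional derivative occurring below is \<open>-\<infinity>\<close>, the corresponding quotient,
  and hence the curvature, is \<open>\<infinity>\<close>; so finite curvature includes finiteness of all
  these derivatives.
\<close>

definition curvature :: "'a::real_vector set \<Rightarrow> ('a \<Rightarrow> real) \<Rightarrow> ereal" where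
  "curvature D f =
    (SUP (x, y, l) \<in> D \<times> D \<times> {0<..<1::real}.
      (ereal (f (x + l *\<^sub>R (y - x)) - f x) - ereal l * dir_deriv f x (y - x)) / ereal (l\<^sup>2))"

definition fw_gap :: "'a::real_vector set \<Rightarrow> ('a \<Rightarrow> real) \<Rightarrow> 'a \<Rightarrow> 'a \<Rightarrow> ereal" where
  "fw_gap D f x s = dir_deriv f x (s - x) - (INF y\<in>D. dir_deriv f x (y - x))"

text \<open>
  The \<open>\<sigma>\<close>-algebra generated by \<open>X\<^sub>0, \<dots>, X\<^sub>n\<close> and \<open>S\<^sub>1, \<dots>, S\<^sub>n\<close>, with respect to the Borel
  \<open>\<sigma>\<close>-algebra of the vector space; the value \<open>S 0\<close> is never used.
\<close>

definition fw_filtration ::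
  "'w measure \<Rightarrow> (nat \<Rightarrow> 'w \<Rightarrow> 'a::topological_space) \<Rightarrow> (nat \<Rightarrow> 'w \<Rightarrow> 'a) \<Rightarrow> nat \<Rightarrow> 'w measure" where
  "fw_filtration M X S n = sigma (space M)
    ({X i -` B \<inter> space M | i B. i \<le> n \<and> B \<in> sets borel} \<union>
     {S i -` B \<inter> space M | i B. 1 \<le> i \<and> i \<le> n \<and> B \<in> sets borel})"

end

theory Submission
  imports Defs
begin

text \<open>
  A step with gap below \<open>\<epsilon>\<close> taken from a point \<open>X\<^sub>n\<close> with \<open>f X\<^sub>n \<ge> f y + 2 \<epsilon>\<close> has slope at most
  \<open>-\<epsilon>\<close>, so finite curvature forces a decrease of \<open>f\<close> by a fixed \<open>\<delta> > 0\<close>. As \<open>f X\<^sub>n\<close> never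
  increases, this can happen only finitely often while \<open>f X\<^sub>n \<ge> f y + 2 \<epsilon>\<close>. The conditional
  Borel--Cantelli lemma gives infinitely many such steps almost surely, for each \<open>\<epsilon> = 1/k\<close>.
\<close>

section \<open>Directional derivatives and curvature of convex functions\<close>

text \<open>The nearer point divides the segment from \<open>x\<close> to the farther one in ratio
  \<open>s/t\<close>, so convexity on that segment compares the slopes. This monotonicity is what
  makes the one-sided limit in \<open>dir_deriv\<close> exist.\<close>

lemma convex_on_quotient_mono:
  fixes f :: "'a::real_vector \<Rightarrow> real"
  assumes f: "convex_on D f" and xy: "x \<in> D" "y \<in> D" and st: "0 < s" "s \<le> t" "t \<le> 1"
  shows "(f (x + s *\<^sub>R (y - x)) - f x) / s \<le> (f (x + t *\<^sub>R (y - x)) - f x) / t"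
proof -
  let ?z = "x + t *\<^sub>R (y - x)"
  have "?z = (1 - t) *\<^sub>R x + t *\<^sub>R y"
    by (simp add: algebra_simps)
  then have z: "?z \<in> D"
    using convexD_alt[OF convex_on_imp_convex[OF f]] xy st by simp
  have "x + s *\<^sub>R (y - x) = (1 - s/t) *\<^sub>R x + (s/t) *\<^sub>R ?z"
    using st by (simp add: algebra_simps)
  then have "f (x + s *\<^sub>R (y - x)) \<le> (1 - s/t) * f x + (s/t) * f ?z"
    using convex_onD[OF f, of "s/t" x ?z] z xy st by simp
  then have "f (x + s *\<^sub>R (y - x)) - f x \<le> s * ((f ?z - f x) / t)"
    by (simp add: algebra_simps diff_divide_distrib)
  then show ?thesis
    using st by (simp add: pos_divide_le_eq mult.commute)
qed

text \<open>\<open>Lim\<close> carries information only once convergence is known. The slopes shrink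
  as \<open>t\<close> decreases to 0, so they converge in \<open>ereal\<close> to their infimum,
  possibly to \<open>-\<infinity>\<close>.\<close>

lemma dir_deriv_eq_INF:
  fixes f :: "'a::real_vector \<Rightarrow> real"
  assumes f: "convex_on D f" and xy: "x \<in> D" "y \<in> D"
  shows "dir_deriv f x (y - x) = (INF t\<in>{0<..1}. ereal ((f (x + t *\<^sub>R (y - x)) - f x) / t))"
    (is "_ = (INF t\<in>_. ?q t)")
proof -
  have "(?q \<longlongrightarrow> (INF t\<in>{0<..1}. ?q t)) (at_right 0)"
  proof (rule order_tendstoI)
    fix a assume a: "a < (INF t\<in>{0<..1}. ?q t)"
    have "a < ?q t" if "0 < t" "t < 1" for t
      using a INF_lower[of t "{0<..1}" ?q] that by fastforce
    then show "\<forall>\<^sub>F t in at_right 0. a < ?q t"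
      by (auto simp: eventually_at_right_field intro!: exI[of _ 1])
  next
    fix a assume "(INF t\<in>{0<..1}. ?q t) < a"
    then obtain t where t: "0 < t" "t \<le> 1" "?q t < a"
      by (auto simp: INF_less_iff)
    \<comment> \<open>A single slope below \<open>a\<close> suffices, since all slopes at smaller
      parameters lie below it.\<close>
    have "?q s < a" if "0 < s" "s < t" for s
      using convex_on_quotient_mono[OF f xy, of s t] that t
      by (meson ereal_less_eq(3) le_less_trans less_imp_le)
    then show "\<forall>\<^sub>F s in at_right 0. ?q s < a"
      using t by (auto simp: eventually_at_right_field)
  qed
  then show ?thesis
    unfolding dir_deriv_def by (intro tendsto_Lim) auto
qed

text \<open>The slope at \<open>t = 1\<close> is one of those in the infimum. This rules out the
  value \<open>\<infinity>\<close> and later bounds the infimum in the gap.\<close>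

lemma dir_deriv_le_diff:
  fixes f :: "'a::real_vector \<Rightarrow> real"
  assumes "convex_on D f" "x \<in> D" "y \<in> D"
  shows "dir_deriv f x (y - x) \<le> ereal (f y - f x)"
  unfolding dir_deriv_eq_INF[OF assms] by (rule INF_lower2[of 1]) auto

text \<open>Solving one quotient of the supremum for the value of \<open>f\<close> gives a quadratic
  upper model along the segment. A derivative \<open>-\<infinity>\<close> would make that quotient
  \<open>\<infinity>\<close>, against the bound \<open>C\<close>.\<close>

lemma curvature_bound:
  fixes f :: "'a::real_vector \<Rightarrow> real"
  assumes f: "convex_on D f" and xy: "x \<in> D" "y \<in> D"
    and C: "curvature D f \<le> ereal C" and l: "0 < l" "l < 1"
  obtains d where "dir_deriv f x (y - x) = ereal d"
    and "f (x + l *\<^sub>R (y - x)) \<le> f x + l * d + l\<^sup>2 * C"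
proof -
  let ?a = "f (x + l *\<^sub>R (y - x)) - f x"
  have le: "(ereal ?a - ereal l * dir_deriv f x (y - x)) / ereal (l\<^sup>2) \<le> ereal C"
    using order_trans[OF _ C] unfolding curvature_def
    using SUP_upper[of "(x, y, l)" "D \<times> D \<times> {0<..<1}"
      "\<lambda>(x, y, l). (ereal (f (x + l *\<^sub>R (y - x)) - f x) - ereal l * dir_deriv f x (y - x)) / ereal (l\<^sup>2)"]
      xy l by auto
  have l2: "0 < l\<^sup>2" using l by simp
  show thesis
  proof (cases "dir_deriv f x (y - x)")
    case (real d)
    with le l2 have "?a - l * d \<le> l\<^sup>2 * C"
      by (simp add: pos_divide_le_eq mult.commute)
    with that[OF real] show thesis by simp
  next
    case PInf
    with dir_deriv_le_diff[OF f xy] show thesis by simp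
  next
    case MInf
    with le l l2 show thesis by simp
  qed
qed

text \<open>The slope is at most \<open>-\<epsilon>\<close>, so the quadratic model falls by at
  least \<open>l * (\<epsilon> - l * C)\<close>. The choice of \<open>l\<close> keeps it below 1 and
  \<open>l * C\<close> at most \<open>\<epsilon> / 2\<close>; it depends on \<open>C\<close> and
  \<open>\<epsilon>\<close> alone, so the decrease is uniform in \<open>x\<close> and
  \<open>s\<close>.\<close>

lemma small_gap_decrease:
  fixes f :: "'a::real_vector \<Rightarrow> real"
  assumes f: "convex_on D f" and D: "x \<in> D" "s \<in> D" "y \<in> D"
    and C: "curvature D f \<le> ereal C" "0 < C" and "0 < \<epsilon>"
    and gap: "fw_gap D f x s < ereal \<epsilon>" and far: "f y + 2 * \<epsilon> \<le> f x"
  defines "l \<equiv> \<epsilon> / (2 * (C + \<epsilon>))"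
  shows "f (x + l *\<^sub>R (s - x)) \<le> f x - l * \<epsilon> / 2"
proof -
  have l: "0 < l" "l < 1" "l * C \<le> \<epsilon> / 2"
    using \<open>0 < \<epsilon>\<close> \<open>0 < C\<close> by (auto simp: l_def field_simps)
  obtain d where d: "dir_deriv f x (s - x) = ereal d"
    and ub: "f (x + l *\<^sub>R (s - x)) \<le> f x + l * d + l\<^sup>2 * C"
    using curvature_bound[OF f D(1,2) C(1) l(1,2)] .
  have "(INF z\<in>D. dir_deriv f x (z - x)) \<le> ereal (f y - f x)"
    using dir_deriv_le_diff[OF f D(1,3)] D(3) by (rule INF_lower2[rotated])
  \<comment> \<open>Only a finite infimum survives: \<open>-\<infinity>\<close> would make the gap
    infinite, and \<open>\<infinity>\<close> contradicts the upper bound just shown.\<close>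
  with gap d have "d < \<epsilon> + (f y - f x)"
    unfolding fw_gap_def by (cases "INF z\<in>D. dir_deriv f x (z - x)") auto
  then have "d \<le> - \<epsilon>" using far by simp
  then have "l * d \<le> l * (- \<epsilon>)" "l * (l * C) \<le> l * (\<epsilon> / 2)"
    using l by (intro mult_left_mono; simp)+
  with ub show ?thesis
    by (simp add: power2_eq_square mult.assoc)
qed

text \<open>A decreasing sequence that is bounded below converges, so its successive differences
  tend to 0 and are eventually smaller than \<open>\<delta>\<close>.\<close>

lemma decseq_frequent_decrease_unbounded:
  fixes g :: "nat \<Rightarrow> real"
  assumes "decseq g" "0 < \<delta>" "\<exists>\<^sub>F n in sequentially. g (Suc n) \<le> g n - \<delta>"
  shows "\<exists>n. g n < b"
proof (rule ccontr)
  assume "\<nexists>n. g n < b"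
  then have "\<And>n. b \<le> g n" by (simp add: not_less)
  with \<open>decseq g\<close> obtain L where L: "g \<longlonglongrightarrow> L"
    using decseq_convergent by metis
  have "(\<lambda>n. g n - g (Suc n)) \<longlonglongrightarrow> L - L"
    by (intro tendsto_diff L LIMSEQ_Suc)
  then have "\<forall>\<^sub>F n in sequentially. g n - g (Suc n) < \<delta>"
    using \<open>0 < \<delta>\<close> by (auto dest: order_tendstoD(2))
  then have "\<forall>\<^sub>F n in sequentially. \<not> g (Suc n) \<le> g n - \<delta>"
    by eventually_elim simp
  with assms(3) show False by (simp add: frequently_def)
qed

section \<open>Conditional Borel--Cantelli lemma\<close>

text \<open>Because the bounds \<open>p n\<close> are deterministic, the probability of missing all
  events from \<open>m\<close> up to \<open>m + k - 1\<close> is at most the exponential of minus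
  the sum of these bounds, which tends to 0 as \<open>k\<close> grows.\<close>

lemma (in prob_space) conditional_Borel_Cantelli:
  assumes sub: "\<And>n. subalgebra M (F n)"
    and mono: "\<And>n. sets (F n) \<subseteq> sets (F (Suc n))"
    and A: "\<And>n. A n \<in> sets (F (Suc n))"
    and p: "\<And>n. AE \<omega> in M. p n \<le> real_cond_exp M (F n) (indicator (A n)) \<omega>"
    and div: "filterlim (\<lambda>N. \<Sum>n<N. p n) at_top sequentially"
  shows "AE \<omega> in M. \<exists>\<^sub>F n in sequentially. \<omega> \<in> A n"
proof -
  have Fspace: "space (F n) = space M" and FM: "sets (F n) \<subseteq> sets M" for n
    using sub[of n] by (auto simp: subalgebra_def)
  have AM[measurable]: "A n \<in> sets M" for n
    using A FM by blast
  \<comment> \<open>Since \<open>B\<close> is known at time \<open>n\<close>, the conditional bound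
    can be integrated over it: \<open>A n\<close> takes up at least the fraction \<open>p n\<close>
    of \<open>B\<close>. Then \<open>1 - p n \<le> exp (- p n)\<close>.\<close>
  have step: "prob (B - A n) \<le> exp (- p n) * prob B" if B: "B \<in> sets (F n)" for B n
  proof -
    interpret finite_measure_subalgebra M "F n"
      by unfold_locales (rule sub)
    have [measurable]: "B \<in> sets M" using B FM by blast
    have int: "integrable M (indicat_real (A n))"
      by (auto intro: integrable_real_indicator simp: emeasure_eq_measure)
    have "p n * prob B = (\<integral>\<omega>\<in>B. p n \<partial>M)"
      by (simp add: set_lebesgue_integral_def)
    also have "\<dots> \<le> (\<integral>\<omega>\<in>B. real_cond_exp M (F n) (indicator (A n)) \<omega> \<partial>M)"
      unfolding set_lebesgue_integral_def
      using p[of n]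
      by (intro integral_mono_AE integrable_mult_indicator real_cond_exp_int int)
        (auto simp: indicator_def)
    also have "\<dots> = (\<integral>\<omega>\<in>B. indicator (A n) \<omega> \<partial>M)"
      using B by (intro real_cond_exp_intA[symmetric] int)
    also have "\<dots> = prob (B \<inter> A n)"
      by (simp add: set_lebesgue_integral_def flip: indicator_inter_arith)
    finally have "prob (B - A n) \<le> (1 - p n) * prob B"
      by (simp add: finite_measure_Diff' algebra_simps)
    also have "\<dots> \<le> exp (- p n) * prob B"
      using exp_ge_add_one_self[of "- p n"] by (intro mult_right_mono) auto
    finally show ?thesis .
  qed
  have null: "prob (\<Inter>n\<in>{m..}. space M - A n) = 0" for m
  proof -
    \<comment> \<open>The strict bound \<open>n < m + k\<close> matters: as \<open>A n\<close> is
      known only at time \<open>Suc n\<close>, it makes \<open>B k\<close> known at time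
      \<open>m + k\<close>, just when \<open>step\<close> is applied to
      \<open>A (m + k)\<close>.\<close>
    define B where "B k = {\<omega> \<in> space M. \<forall>n. m \<le> n \<and> n < m + k \<longrightarrow> \<omega> \<notin> A n}" for k
    have B_Suc: "B (Suc k) = B k - A (m + k)" for k
      by (auto simp: B_def less_Suc_eq)
    have B0: "B 0 = space M" by (auto simp: B_def)
    have BF: "B k \<in> sets (F (m + k))" for k
    proof (induction k)
      case 0
      show ?case unfolding B0 using sets.top[of "F m"] Fspace by simp
    next
      case (Suc k)
      then show ?case
        unfolding B_Suc using mono[of "m + k"] A[of "m + k"] by auto
    qed
    have bound: "prob (B k) \<le> exp (- (\<Sum>n=m..<m+k. p n))" for k
    proof (induction k)
      case (Suc k)
      have "prob (B (Suc k)) \<le> exp (- p (m + k)) * prob (B k)"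
        unfolding B_Suc by (rule step[OF BF])
      also have "\<dots> \<le> exp (- p (m + k)) * exp (- (\<Sum>n=m..<m+k. p n))"
        using Suc by simp
      finally show ?case by (simp add: exp_add[symmetric] algebra_simps)
    qed simp
    have "filterlim (\<lambda>k. (\<Sum>n<k+m. p n)) at_top sequentially"
      by (rule filterlim_compose[OF div filterlim_add_const_nat_at_top])
    then have "filterlim (\<lambda>k. - (\<Sum>n<m. p n) + (\<Sum>n<k+m. p n)) at_top sequentially"
      by (rule filterlim_tendsto_add_at_top[OF tendsto_const])
    moreover have "- (\<Sum>n<m. p n) + (\<Sum>n<k+m. p n) = (\<Sum>n=m..<m+k. p n)" for k
      using sum_diff_nat_ivl[of 0 m "m + k" p]
      by (simp add: lessThan_atLeast0 add.commute)
    ultimately have "filterlim (\<lambda>k. (\<Sum>n=m..<m+k. p n)) at_top sequentially"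
      by simp
    then have lim: "(\<lambda>k. exp (- (\<Sum>n=m..<m+k. p n))) \<longlonglongrightarrow> 0"
      by (rule filterlim_compose[OF exp_at_bot filterlim_uminus_at_top[THEN iffD1]])
    have "prob (\<Inter>n\<in>{m..}. space M - A n) \<le> exp (- (\<Sum>n=m..<m+k. p n))" for k
    proof -
      have "prob (\<Inter>n\<in>{m..}. space M - A n) \<le> prob (B k)"
      proof (rule finite_measure_mono)
        show "(\<Inter>n\<in>{m..}. space M - A n) \<subseteq> B k"
          unfolding B_def by blast
        show "B k \<in> events"
          using BF[of k] FM by blast
      qed
      with bound[of k] show ?thesis by simp
    qed
    then have "prob (\<Inter>n\<in>{m..}. space M - A n) \<le> 0"
      by (intro LIMSEQ_le_const[OF lim]) auto
    then show ?thesis by (simp add: measure_le_0_iff)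
  qed
  \<comment> \<open>Failing to hit infinitely often means missing everything from some
    \<open>m\<close> on, and there are only countably many \<open>m\<close>.\<close>
  have "AE \<omega> in M. \<omega> \<notin> (\<Inter>n\<in>{m..}. space M - A n)" for m
  proof (intro AE_not_in null_setsI)
    show "emeasure M (\<Inter>n\<in>{m..}. space M - A n) = 0"
      by (simp only: emeasure_eq_measure null ennreal_0)
    show "(\<Inter>n\<in>{m..}. space M - A n) \<in> sets M"
      by (rule sets.countable_INT') auto
  qed
  then have "AE \<omega> in M. \<forall>m. \<omega> \<notin> (\<Inter>n\<in>{m..}. space M - A n)"
    by (simp add: AE_all_countable)
  then show ?thesis
    using AE_space by eventually_elim (auto simp: frequently_sequentially)
qed

section \<open>The filtration generated by the algorithm\<close>

lemma sets_fw_filtration: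
  "sets (fw_filtration M X S n) = sigma_sets (space M)
    ({X i -` B \<inter> space M | i B. i \<le> n \<and> B \<in> sets borel} \<union>
     {S i -` B \<inter> space M | i B. 1 \<le> i \<and> i \<le> n \<and> B \<in> sets borel})"
  unfolding fw_filtration_def by (rule sets_measure_of) blast

lemma space_fw_filtration: "space (fw_filtration M X S n) = space M"
  unfolding fw_filtration_def by (rule space_measure_of) blast

lemma subalgebra_fw_filtration:
  assumes X: "\<And>n. X n \<in> M \<rightarrow>\<^sub>M borel" and S: "\<And>n. S (Suc n) \<in> M \<rightarrow>\<^sub>M borel"
  shows "subalgebra M (fw_filtration M X S n)"
proof -
  have "S i \<in> M \<rightarrow>\<^sub>M borel" if "1 \<le> i" for i
    using S[of "i - 1"] that by simp
  then have "sets (fw_filtration M X S n) \<subseteq> sets M"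
    unfolding sets_fw_filtration
    by (intro sets.sigma_sets_subset) (auto intro: measurable_sets X)
  then show ?thesis
    by (simp add: subalgebra_def space_fw_filtration)
qed

lemma sets_fw_filtration_Suc:
  "sets (fw_filtration M X S n) \<subseteq> sets (fw_filtration M X S (Suc n))"
  unfolding sets_fw_filtration
  by (intro sigma_sets_mono' Un_mono Collect_mono) (metis le_Suc_eq)+

theorem proposition4p2:
  fixes D :: "'a::locally_convex_t2_space set"
    and f :: "'a \<Rightarrow> real"
    and M :: "'w measure"
    and X S :: "nat \<Rightarrow> 'w \<Rightarrow> 'a"
    and lam :: "nat \<Rightarrow> 'w \<Rightarrow> real"
    and p :: "nat \<Rightarrow> real \<Rightarrow> real"
  assumes "D \<noteq> {}" and "convex D" and "convex_on D f"
    and "curvature D f < \<infinity>"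
    and "\<And>x s. x \<in> D \<Longrightarrow> s \<in> D \<Longrightarrow> fw_gap D f x s < \<infinity>"
    and "prob_space M"
    and "\<And>n. X n \<in> M \<rightarrow>\<^sub>M borel"
    and "\<And>n. S (Suc n) \<in> M \<rightarrow>\<^sub>M borel"
    and "\<And>n \<omega>. \<omega> \<in> space M \<Longrightarrow> X n \<omega> \<in> D"
    and "\<And>n \<omega>. \<omega> \<in> space M \<Longrightarrow> S (Suc n) \<omega> \<in> D"
    and "\<And>n \<omega>. \<omega> \<in> space M \<Longrightarrow>
      is_arg_min (\<lambda>l. f ((1 - l) *\<^sub>R X n \<omega> + l *\<^sub>R S (Suc n) \<omega>)) (\<lambda>l. l \<in> {0..1}) (lam n \<omega>)"
    and "\<And>n \<omega>. \<omega> \<in> space M \<Longrightarrow>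
      f (X (Suc n) \<omega>) \<le> f ((1 - lam n \<omega>) *\<^sub>R X n \<omega> + lam n \<omega> *\<^sub>R S (Suc n) \<omega>)"
    and "\<And>n. (\<lambda>\<omega>. fw_gap D f (X n \<omega>) (S (Suc n) \<omega>))
      \<in> borel_measurable (fw_filtration M X S (Suc n))"
    and "\<And>n \<epsilon>. \<epsilon> > 0 \<Longrightarrow> p n \<epsilon> > 0"
    and "\<And>n \<epsilon>. \<epsilon> > 0 \<Longrightarrow>
      AE \<omega> in M. real_cond_exp M (fw_filtration M X S n)
        (indicator {\<omega> \<in> space M. fw_gap D f (X n \<omega>) (S (Suc n) \<omega>) < ereal \<epsilon>}) \<omega> \<ge> p n \<epsilon>"
    and "\<And>\<epsilon>. \<epsilon> > 0 \<Longrightarrow> filterlim (\<lambda>N. \<Sum>n=1..N. p n \<epsilon>) at_top sequentially"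
  shows "AE \<omega> in M. (\<lambda>n. ereal (f (X n \<omega>))) \<longlonglongrightarrow> (INF x\<in>D. ereal (f x))"
proof -
  interpret prob_space M by fact
  note f = assms(3) and XD = assms(9) and SD = assms(10) and argmin = assms(11) and desc = assms(12)
  define A where "A \<epsilon> n = {\<omega> \<in> space M. fw_gap D f (X n \<omega>) (S (Suc n) \<omega>) < ereal \<epsilon>}" for \<epsilon> n
  have io: "AE \<omega> in M. \<exists>\<^sub>F n in sequentially. \<omega> \<in> A \<epsilon> n" if "0 < \<epsilon>" for \<epsilon>
  proof (rule conditional_Borel_Cantelli[where F = "fw_filtration M X S" and p = "\<lambda>n. p n \<epsilon>"])
    show sub: "subalgebra M (fw_filtration M X S n)" for n
      by (intro subalgebra_fw_filtration) (use assms(7,8) in simp_all)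
    show "sets (fw_filtration M X S n) \<subseteq> sets (fw_filtration M X S (Suc n))" for n
      by (rule sets_fw_filtration_Suc)
    show "A \<epsilon> n \<in> sets (fw_filtration M X S (Suc n))" for n
      using measurable_sets[OF assms(13), of "{..<ereal \<epsilon>}" n] sub[of "Suc n"]
      by (simp add: A_def subalgebra_def vimage_def Int_def conj_commute)
    show "AE \<omega> in M. p n \<epsilon> \<le> real_cond_exp M (fw_filtration M X S n) (indicator (A \<epsilon> n)) \<omega>" for n
      using assms(15)[OF that, of n] by (simp add: A_def)
    \<comment> \<open>The assumed series starts at index 1 but the Borel--Cantelli lemma sums from
      0; the extra constant term preserves divergence.\<close>
    have "filterlim (\<lambda>N. p 0 \<epsilon> + (\<Sum>n=1..N. p n \<epsilon>)) at_top sequentially"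
      by (rule filterlim_tendsto_add_at_top[OF tendsto_const assms(16)[OF that]])
    moreover have "p 0 \<epsilon> + (\<Sum>n=1..N. p n \<epsilon>) = (\<Sum>n<Suc N. p n \<epsilon>)" for N
      by (simp add: sum.atMost_shift lessThan_Suc_atMost sum.atLeast1_atMost_eq)
    ultimately have "filterlim (\<lambda>N. \<Sum>n<Suc N. p n \<epsilon>) at_top sequentially"
      by simp
    then show "filterlim (\<lambda>N. \<Sum>n<N. p n \<epsilon>) at_top sequentially"
      by (rule filterlim_sequentially_Suc[THEN iffD1])
  qed
  \<comment> \<open>Enlarging the curvature bound to a positive real provides the sign required by
    \<open>small_gap_decrease\<close>.\<close>
  obtain C where C: "curvature D f \<le> ereal C" "0 < C"
  proof (cases "curvature D f")
    case (real c)
    then show thesis by (intro that[of "max c 1"]) auto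
  qed (use assms(4) that[of 1] in auto)
  \<comment> \<open>From here the argument is deterministic along one path. Restricting to countably
    many tolerances lets the exceptional null sets be united at the end.\<close>
  have pointwise: "(\<lambda>n. ereal (f (X n \<omega>))) \<longlonglongrightarrow> (INF x\<in>D. ereal (f x))"
    if \<omega>: "\<omega> \<in> space M"
      and freq: "\<And>k. \<exists>\<^sub>F n in sequentially. \<omega> \<in> A (inverse (real (Suc k))) n" for \<omega>
  proof -
    \<comment> \<open>Exact line search does at least as well as any fixed step \<open>l\<close>.
      Below, \<open>l = 0\<close> gives monotonicity and the \<open>l\<close> of
      \<open>small_gap_decrease\<close> gives the uniform drop.\<close>
    have step: "f (X (Suc n) \<omega>) \<le> f (X n \<omega> + l *\<^sub>R (S (Suc n) \<omega> - X n \<omega>))"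
      if "0 \<le> l" "l \<le> 1" for n l
    proof -
      have "f ((1 - lam n \<omega>) *\<^sub>R X n \<omega> + lam n \<omega> *\<^sub>R S (Suc n) \<omega>)
          \<le> f ((1 - l) *\<^sub>R X n \<omega> + l *\<^sub>R S (Suc n) \<omega>)"
        using argmin[OF \<omega>, of n] that by (auto simp: is_arg_min_def not_less)
      with desc[OF \<omega>, of n] show ?thesis
        by (simp add: algebra_simps)
    qed
    have dec: "decseq (\<lambda>n. f (X n \<omega>))"
      using step[of 0] by (intro decseq_SucI) simp
    have close: "\<exists>n. f (X n \<omega>) < f y + 2 * \<epsilon>" if y: "y \<in> D" and e: "\<epsilon> = inverse (real (Suc k))" for y \<epsilon> k
    proof (rule ccontr)
      assume "\<not> ?thesis"
      then have far: "\<And>n. f y + 2 * \<epsilon> \<le> f (X n \<omega>)" by (simp add: not_less)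
      have "0 < \<epsilon>" using e by simp
      define l where "l = \<epsilon> / (2 * (C + \<epsilon>))"
      have l: "0 < l" "l \<le> 1" using \<open>0 < \<epsilon>\<close> C by (auto simp: l_def field_simps)
      have "f (X (Suc n) \<omega>) \<le> f (X n \<omega>) - l * \<epsilon> / 2" if "\<omega> \<in> A \<epsilon> n" for n
      proof -
        have "fw_gap D f (X n \<omega>) (S (Suc n) \<omega>) < ereal \<epsilon>" using that by (simp add: A_def)
        then have "f (X n \<omega> + l *\<^sub>R (S (Suc n) \<omega> - X n \<omega>)) \<le> f (X n \<omega>) - l * \<epsilon> / 2"
          unfolding l_def
          using small_gap_decrease[OF f XD[OF \<omega>] SD[OF \<omega>] y C \<open>0 < \<epsilon>\<close> _ far] by blast
        with step[of l n] l show ?thesis by simp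
      qed
      then have "\<exists>\<^sub>F n in sequentially. f (X (Suc n) \<omega>) \<le> f (X n \<omega>) - l * \<epsilon> / 2"
        using freq[of k] e by (auto elim: frequently_elim1)
      then have "\<exists>n. f (X n \<omega>) < f y"
        using l \<open>0 < \<epsilon>\<close> by (intro decseq_frequent_decrease_unbounded[OF dec, of "l * \<epsilon> / 2"]) auto
      with far \<open>0 < \<epsilon>\<close> show False by (smt (verit))
    qed
    show ?thesis
    proof (rule order_tendstoI)
      fix a assume "a < (INF x\<in>D. ereal (f x))"
      then have "a < ereal (f (X n \<omega>))" for n
        using INF_lower[OF XD[OF \<omega>, of n], of "\<lambda>x. ereal (f x)"] by (rule less_le_trans)
      then show "\<forall>\<^sub>F n in sequentially. a < ereal (f (X n \<omega>))" by simp
    next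
      fix a assume "(INF x\<in>D. ereal (f x)) < a"
      then obtain y where y: "y \<in> D" "ereal (f y) < a" by (auto simp: INF_less_iff)
      \<comment> \<open>The bound \<open>a\<close> may be \<open>\<infinity>\<close>, so a real
        \<open>r\<close> is inserted; \<open>k\<close> is then chosen to fit twice the tolerance
        between \<open>f y\<close> and \<open>r\<close>.\<close>
      then obtain r where r: "f y < r" "ereal r < a"
        using ereal_dense2 by (metis less_ereal.simps(1))
      obtain k where "inverse (real (Suc k)) < (r - f y) / 2"
        using reals_Archimedean[of "(r - f y) / 2"] r by auto
      moreover obtain N where "f (X N \<omega>) < f y + 2 * inverse (real (Suc k))"
        using close[OF y(1) refl, of k] by blast
      ultimately have "f (X N \<omega>) < r" by argo
      then have "f (X n \<omega>) < r" if "N \<le> n" for n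
        using decseqD[OF dec that] by simp
      then have "ereal (f (X n \<omega>)) < a" if "N \<le> n" for n
        using that r(2) by (metis less_ereal.simps(1) less_trans)
      then show "\<forall>\<^sub>F n in sequentially. ereal (f (X n \<omega>)) < a"
        by (auto simp: eventually_sequentially)
    qed
  qed
  have "AE \<omega> in M. \<forall>k. \<exists>\<^sub>F n in sequentially. \<omega> \<in> A (inverse (real (Suc k))) n"
    by (subst AE_all_countable) (intro allI io, simp)
  then show ?thesis
    using AE_space by eventually_elim (rule pointwise, auto)
qed

end
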